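(* Let $n\ge 1$ be an integer, and for $0\le k,l<n$ let $$\mathbf{B}(k,l)=\sum_{0\le j<n}\left(\mathbf{e}_{j}\mathbf{e}_{(j+k \bmod n)}^{t}\right)\exp\left\{ i\frac{2\pi}{n}\,j\,l\right\}\in\mathbb{C}^{n\times n}.$$ Then every $\mathbf{B}(k,l)$ has full rank, and the set $F_n=\{\mathbf{B}(k,l)\}_{0\le k,l<n}$ is an $n$-pseudo-closed complete orthogonal basis spanning the vector space of $n\times n$ complex matrices.
   Context: $\{\mathbf{e}_j\}_{0\le j<n}$ is the canonical basis of $n$-dimensional column vectors, with indices starting at $0$. In the exponential, $i=\sqrt{-1}$. The space $\mathbb{C}^{n\times n}$ carries the inner product $\langle \mathbf{A},\mathbf{M}\rangle := \mathrm{Tr}(\mathbf{A}\mathbf{M}^{\dagger})$, where $\dagger$ is the conjugate transpose; orthogonality refers to this inner product. An orthogonal basis of a subspace of $\mathbb{C}^{n\times n}$ is called complete if it spans all of $\mathbb{C}^{n\times n}$. For $\mathbf{A}=(a_{i,j})_{0\le i,j<n}$ and an integer $m\ge 1$, let $\mathbf{A}^{\star^{m}}:=(a_{i,j}^{m})_{0\le i,j<n}$ be the entrywise $m$-th power. Definition ($k$-pseudo-closure). Let $k\ge 1$ and let $G$ be an orthogonal basis of a subspace of $\mathbb{C}^{n\times n}$. $G$ is called $k$-pseudo-closed if for all $\mathbf{A},\mathbf{B}\in G$ one has $\mathbf{A}^{\star^{k+1}}=\mathbf{A}$ and $\mathbf{B}^{\star^{k+1}}=\mathbf{B}$, and there exists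 a diagonal matrix $\mathbf{D}$ with $\mathbf{D}^{k}=\mathbf{I}$ such that $\mathbf{D}(\mathbf{A}\mathbf{B})\in G$ (ordinary matrix products). *)

theory Defs
  imports
    Complex_Main
    "Jordan_Normal_Form.DL_Rank"
    "Jordan_Normal_Form.Schur_Decomposition"
begin

abbreviation cmat_space :: "nat \<Rightarrow> (complex, complex mat) module" where
  "cmat_space n \<equiv> module_mat TYPE(complex) n n"

definition mat_trace :: "complex mat \<Rightarrow> complex" where
  "mat_trace A = (\<Sum>i<dim_row A. A $$ (i, i))"

definition mat_inner :: "complex mat \<Rightarrow> complex mat \<Rightarrow> complex" where
  "mat_inner A M = mat_trace (A * mat_adjoint M)"

definition entrywise_pow :: "complex mat \<Rightarrow> nat \<Rightarrow> complex mat" where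
  "entrywise_pow A m = map_mat (\<lambda>a. a ^ m) A"

text \<open>Being a basis of \<open>W\<close> is the notion of the vector space library, relative to the
  subspace \<open>W\<close> as a vector space in its own right; it entails linear independence.\<close>

definition orthogonal_basis_of :: "nat \<Rightarrow> complex mat set \<Rightarrow> complex mat set \<Rightarrow> bool" where
  "orthogonal_basis_of n W G \<longleftrightarrow>
     VectorSpace.subspace class_ring W (cmat_space n) \<and>
     vectorspace.basis class_ring ((cmat_space n)\<lparr>carrier := W\<rparr>) G \<and>
     (\<forall>A\<in>G. \<forall>M\<in>G. A \<noteq> M \<longrightarrow> mat_inner A M = 0)"

definition orthogonal_basis :: "nat \<Rightarrow> complex mat set \<Rightarrow> bool" where
  "orthogonal_basis n G \<longleftrightarrow> (\<exists>W. orthogonal_basis_of n W G)"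

definition complete_orthogonal_basis :: "nat \<Rightarrow> complex mat set \<Rightarrow> bool" where
  "complete_orthogonal_basis n G \<longleftrightarrow>
     orthogonal_basis n G \<and>
     LinearCombinations.module.span class_ring (cmat_space n) G = carrier_mat n n"

text \<open>The diagonal matrix \<open>D\<close> may depend on the pair \<open>A\<close>, \<open>B\<close>.\<close>

definition pseudo_closed :: "nat \<Rightarrow> nat \<Rightarrow> complex mat set \<Rightarrow> bool" where
  "pseudo_closed n k G \<longleftrightarrow>
     k \<ge> 1 \<and> orthogonal_basis n G \<and>
     (\<forall>A\<in>G. \<forall>B\<in>G.
        entrywise_pow A (k + 1) = A \<and> entrywise_pow B (k + 1) = B \<and>
        (\<exists>D\<in>carrier_mat n n. diagonal_mat D \<and> D ^\<^sub>m k = 1\<^sub>m n \<and> D * (A * B) \<in> G))"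

definition basis_col :: "nat \<Rightarrow> nat \<Rightarrow> complex mat" where
  "basis_col n j = mat_of_cols n [unit_vec n j]"

text \<open>Matrices of all dimensions share one type, which therefore has no zero element; the sum
  over \<open>j\<close> is taken in the additive group of \<open>n \<times> n\<close> matrices.\<close>

definition B_mat :: "nat \<Rightarrow> nat \<Rightarrow> nat \<Rightarrow> complex mat" where
  "B_mat n k l =
     finsum (cmat_space n)
       (\<lambda>j. exp (\<i> * (2 * complex_of_real pi / of_nat n) * of_nat j * of_nat l) \<cdot>\<^sub>m
              (basis_col n j * transpose_mat (basis_col n ((j + k) mod n))))
       {0..<n}"

definition F_set :: "nat \<Rightarrow> complex mat set" where
  "F_set n = {B_mat n k l | k l. k < n \<and> l < n}"

end

theory Submission
  imports Defs "HOL-Number_Theory.Cong"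
begin

text \<open>
  Write \<open>\<omega>\<close> for the primitive root of unity \<open>exp (2 \<pi> i / n)\<close>. The matrix \<open>B(k, l)\<close> is a diagonal
  matrix of characters times a cyclic shift: row \<open>j\<close> has the single nonzero entry \<open>\<omega>^(j l)\<close>, in
  column \<open>j + k mod n\<close>. Everything follows from this description of the entries
  (\<open>B_mat_index\<close>).

  \<^item> Two of these matrices with different shifts have disjoint supports; with equal shifts their inner
    product is the inner product of two characters of \<open>\<int>/n\<close>. Hence the inner product of \<open>B(k, l)\<close>
    with \<open>B(k', l')\<close> is \<open>n\<close> if the indices agree and \<open>0\<close> otherwise (\<open>B_mat_gram\<close>). Orthogonality,
    injectivity of the parametrisation and linear independence are consequences.

  \<^item> The \<open>k\<close>-th cyclic diagonal of a matrix \<open>M\<close> is a function on \<open>\<int>/n\<close> whose Fourier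
    coefficients are the inner products of \<open>M\<close> with the \<open>B(k, l)\<close>. Fourier inversion on every cyclic
    diagonal recovers \<open>M\<close> (\<open>F_set_expansion\<close>), so the family spans.

  \<^item> Moving a shift past a diagonal of characters costs a scalar, whence
    \<open>B(k, l) B(k', l') = \<omega>^(k l') B(k + k', l + l')\<close> (\<open>B_mat_mult\<close>). The scalar is an \<open>n\<close>-th root of
    unity, so its inverse times the identity is the diagonal matrix that pseudo-closure requires.

  \<^item> Each \<open>B(k, l)\<close> is unitary, hence of full rank (\<open>B_mat_rank\<close>).
\<close>

section \<open>Arithmetic modulo n and roots of unity\<close>

definition unit_root :: "nat \<Rightarrow> complex" where
  "unit_root n = cis (2 * pi / real n)"

lemma unit_root_power: "unit_root n ^ a = cis (2 * pi * real a / real n)"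
  by (simp add: unit_root_def DeMoivre algebra_simps)

lemma unit_root_power_self: "n \<ge> 1 \<Longrightarrow> unit_root n ^ n = 1"
  by (simp add: unit_root_power)

lemma unit_root_power_mod:
  assumes "n \<ge> 1"
  shows "unit_root n ^ (a mod n) = unit_root n ^ a"
proof -
  have "unit_root n ^ a = unit_root n ^ (n * (a div n) + a mod n)"
    by simp
  also have "\<dots> = unit_root n ^ (a mod n)"
    by (simp only: power_add power_mult unit_root_power_self[OF assms]) simp
  finally show ?thesis ..
qed

lemma unit_root_power_power_eq_1:
  assumes "n \<ge> 1"
  shows "(unit_root n ^ a) ^ n = 1"
  using unit_root_power_self[OF assms] by (metis power_commutes power_mult mult.commute power_one)

lemma unit_root_mult_cnj: "unit_root n ^ a * cnj (unit_root n ^ a) = 1"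
  by (simp add: unit_root_power complex_norm_square[symmetric])

text \<open>The sum is geometric with ratio \<open>z = \<omega>^(a - b)\<close>, an \<open>n\<close>-th root of unity other than \<open>1\<close>
  when \<open>a\<close> and \<open>b\<close> are distinct residues, so that it equals \<open>(1 - z^n) / (1 - z) = 0\<close>.\<close>

lemma unit_root_orthogonal:
  assumes "a < n" "b < n"
  shows "(\<Sum>j<n. unit_root n ^ (j * a) * cnj (unit_root n ^ (j * b))) = (if a = b then of_nat n else 0)"
proof (cases "a = b")
  case True
  then show ?thesis
    by (simp only: unit_root_mult_cnj) simp
next
  case False
  have n: "n \<ge> 1"
    using assms by simp
  define z where "z = unit_root n ^ a * cnj (unit_root n ^ b)"
  have "inj_on (\<lambda>k. unit_root n ^ k) {..<n}"
    using bij_betw_roots_unity[of n] n by (simp add: unit_root_power bij_betw_def)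
  then have neq: "unit_root n ^ a \<noteq> unit_root n ^ b"
    using False assms by (auto dest: inj_onD)
  have "z \<noteq> 1"
  proof
    assume "z = 1"
    then have "unit_root n ^ b = z * unit_root n ^ b"
      by simp
    also have "\<dots> = unit_root n ^ a * (unit_root n ^ b * cnj (unit_root n ^ b))"
      by (simp only: z_def mult_ac)
    finally show False
      using neq by (simp only: unit_root_mult_cnj) simp
  qed
  have "z ^ n = (unit_root n ^ a) ^ n * cnj ((unit_root n ^ b) ^ n)"
    by (simp only: z_def power_mult_distrib complex_cnj_power)
  also have "\<dots> = 1"
    by (simp only: unit_root_power_power_eq_1[OF n]) simp
  finally have zn: "z ^ n = 1" .
  have "(\<Sum>j<n. unit_root n ^ (j * a) * cnj (unit_root n ^ (j * b))) = (\<Sum>j<n. z ^ j)"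
    by (simp only: z_def power_mult_distrib power_mult[symmetric] complex_cnj_power[symmetric] mult.commute)
  also have "\<dots> = 0"
    using \<open>z \<noteq> 1\<close> zn by (simp add: sum_gp_strict)
  finally show ?thesis
    using False by simp
qed

text \<open>Every row \<open>i\<close> meets each cyclic diagonal \<open>k\<close> exactly once, in column \<open>i + k mod n\<close>; this turns sums
  over diagonals into sums over columns.\<close>

lemma bij_betw_add_mod:
  fixes n i :: nat
  shows "bij_betw (\<lambda>k. (i + k) mod n) {..<n} {..<n}"
proof -
  have inj: "inj_on (\<lambda>k. (i + k) mod n) {..<n}"
  proof (rule inj_onI)
    fix x y assume "x \<in> {..<n}" "y \<in> {..<n}" "(i + x) mod n = (i + y) mod n"
    then show "x = y"
      using cong_add_lcancel_nat[of i x y n] by (simp add: cong_def)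
  qed
  have "(\<lambda>k. (i + k) mod n) ` {..<n} \<subseteq> {..<n}"
    by auto
  then have "(\<lambda>k. (i + k) mod n) ` {..<n} = {..<n}"
    using inj by (simp add: endo_inj_surj)
  then show ?thesis
    using inj by (simp add: bij_betw_def)
qed

section \<open>Entries, inner products and linear independence of matrices\<close>

lemma finsum_mat_closed:
  assumes "f \<in> X \<rightarrow> carrier_mat n n"
  shows "finsum (cmat_space n) f X \<in> carrier_mat n n"
proof -
  interpret abelian_group "cmat_space n"
    by (rule abelian_group_mat)
  show ?thesis
    using finsum_closed[of f X] assms by (simp add: module_mat_simps)
qed

text \<open>The sum in the additive group of matrices is abstract; this reduces it to ordinary sums of entries.\<close>

lemma finsum_mat_index:
  assumes "f \<in> X \<rightarrow> carrier_mat n n" "i < n" "j < n"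
  shows "finsum (cmat_space n) f X $$ (i, j) = (\<Sum>x\<in>X. f x $$ (i, j))"
proof -
  interpret abelian_group "cmat_space n"
    by (rule abelian_group_mat)
  note [simp] = module_mat_simps
  show ?thesis
    using assms(1)
  proof (induction X rule: infinite_finite_induct)
    case (infinite X)
    then show ?case
      using assms by (simp add: finsum_infinite)
  next
    case empty
    then show ?case
      using assms by simp
  next
    case (insert x X)
    then have "f x \<in> carrier_mat n n" "f \<in> X \<rightarrow> carrier_mat n n"
      by auto
    then show ?case
      using insert assms finsum_mat_closed[of f X n] finsum_insert[of X x f] by auto
  qed
qed

lemma mat_adjoint_index:
  fixes M :: "complex mat"
  assumes "M \<in> carrier_mat n n" "i < n" "j < n"
  shows "mat_adjoint M $$ (i, j) = cnj (M $$ (j, i))"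
  using assms by (auto simp: mat_adjoint_def mat_of_rows_def)

lemma mat_adjoint_carrier:
  fixes M :: "complex mat"
  assumes "M \<in> carrier_mat n n"
  shows "mat_adjoint M \<in> carrier_mat n n"
  using assms by (auto simp: mat_adjoint_def)

lemma mat_times_index:
  fixes A C :: "complex mat"
  assumes "A \<in> carrier_mat n n" "C \<in> carrier_mat n n" "i < n" "j < n"
  shows "(A * C) $$ (i, j) = (\<Sum>m<n. A $$ (i, m) * C $$ (m, j))"
  using assms by (auto simp: scalar_prod_def atLeast0LessThan)

lemma mat_inner_eq_sum:
  assumes "A \<in> carrier_mat n n" "M \<in> carrier_mat n n"
  shows "mat_inner A M = (\<Sum>i<n. \<Sum>j<n. A $$ (i, j) * cnj (M $$ (i, j)))"
proof -
  have "mat_inner A M = (\<Sum>i<n. (A * mat_adjoint M) $$ (i, i))"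
    using assms by (simp add: mat_inner_def mat_trace_def)
  also have "\<dots> = (\<Sum>i<n. \<Sum>j<n. A $$ (i, j) * cnj (M $$ (i, j)))"
    using assms
    by (intro sum.cong refl)
      (simp add: mat_times_index[OF _ mat_adjoint_carrier] mat_adjoint_index)
  finally show ?thesis .
qed

lemma smult_smult_mat: "a \<cdot>\<^sub>m (b \<cdot>\<^sub>m A) = (a * b) \<cdot>\<^sub>m (A :: complex mat)"
  by auto

lemma smult_one_mat_pow: "(c \<cdot>\<^sub>m 1\<^sub>m n) ^\<^sub>m k = c ^ k \<cdot>\<^sub>m (1\<^sub>m n :: complex mat)"
proof (induction k)
  case 0
  show ?case
    by auto
next
  case (Suc k)
  then show ?case
    by (simp add: mult_smult_assoc_mat[of _ n n _ n] left_mult_one_mat[of _ n n] smult_smult_mat mult.commute)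
qed

text \<open>Pairing a vanishing linear combination with a member of the family leaves only the coefficient
  of that member, times its nonzero square norm.\<close>

lemma lin_indpt_of_orthogonal:
  assumes fin: "finite G" and G: "G \<subseteq> carrier_mat n n"
    and orth: "\<And>A M. A \<in> G \<Longrightarrow> M \<in> G \<Longrightarrow> A \<noteq> M \<Longrightarrow> mat_inner A M = 0"
    and nz: "\<And>A. A \<in> G \<Longrightarrow> mat_inner A A \<noteq> 0"
  shows "\<not> LinearCombinations.module.lin_dep class_ring (cmat_space n) G"
proof -
  interpret V: vectorspace class_ring "cmat_space n"
    by (rule matrix_vs)
  show ?thesis
  proof (rule V.finite_lin_indpt2[OF fin])
    show "G \<subseteq> carrier (cmat_space n)"
      using G by (simp add: module_mat_simps)
  next
    fix a :: "complex mat \<Rightarrow> complex"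
    assume z: "V.lincomb a G = \<zero>\<^bsub>cmat_space n\<^esub>"
    have f: "(\<lambda>A. a A \<cdot>\<^sub>m A) \<in> G \<rightarrow> carrier_mat n n"
      using G by auto
    have idx: "(\<Sum>A\<in>G. a A * A $$ (i, j)) = 0" if ij: "i < n" "j < n" for i j
    proof -
      have "(\<Sum>A\<in>G. a A * A $$ (i, j)) = (\<Sum>A\<in>G. (a A \<cdot>\<^sub>m A) $$ (i, j))"
        using G ij by (intro sum.cong) auto
      also have "\<dots> = V.lincomb a G $$ (i, j)"
        using finsum_mat_index[OF f ij] by (simp add: V.lincomb_def module_mat_simps)
      finally show ?thesis
        using z ij by (simp add: module_mat_simps)
    qed
    show "\<forall>M\<in>G. a M = \<zero>\<^bsub>class_ring\<^esub>"
    proof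
      fix M assume M: "M \<in> G"
      have "a M * mat_inner M M = (\<Sum>A\<in>G. a A * mat_inner A M)"
        using M orth by (subst sum.remove[OF fin M]) simp
      also have "\<dots> = (\<Sum>A\<in>G. \<Sum>i<n. \<Sum>j<n. a A * A $$ (i, j) * cnj (M $$ (i, j)))"
        using G M
        by (intro sum.cong refl, subst mat_inner_eq_sum) (auto simp: sum_distrib_left mult.assoc)
      also have "\<dots> = (\<Sum>i<n. \<Sum>A\<in>G. \<Sum>j<n. a A * A $$ (i, j) * cnj (M $$ (i, j)))"
        by (rule sum.swap)
      also have "\<dots> = (\<Sum>i<n. \<Sum>j<n. \<Sum>A\<in>G. a A * A $$ (i, j) * cnj (M $$ (i, j)))"
        by (rule sum.cong[OF refl], rule sum.swap)
      also have "\<dots> = 0"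
        by (simp add: idx flip: sum_distrib_right)
      finally show "a M = \<zero>\<^bsub>class_ring\<^esub>"
        using nz[OF M] by simp
    qed
  qed
qed

section \<open>The matrices B(k, l)\<close>

lemma basis_col_outer_index:
  assumes "p < n" "q < n" "i < n" "j < n"
  shows "(basis_col n p * transpose_mat (basis_col n q)) $$ (i, j) = (if i = p \<and> j = q then 1 else 0)"
  using assms by (simp add: basis_col_def scalar_prod_def mat_of_cols_def)

lemma B_mat_eq:
  "B_mat n k l = finsum (cmat_space n)
     (\<lambda>p. unit_root n ^ (p * l) \<cdot>\<^sub>m (basis_col n p * transpose_mat (basis_col n ((p + k) mod n)))) {0..<n}"
proof -
  have "exp (\<i> * (2 * complex_of_real pi / of_nat n) * of_nat p * of_nat l) = unit_root n ^ (p * l)" for p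
    by (simp add: unit_root_power cis_conv_exp algebra_simps)
  then show ?thesis
    by (simp only: B_mat_def)
qed

lemma B_mat_carrier: "B_mat n k l \<in> carrier_mat n n"
  unfolding B_mat_eq by (rule finsum_mat_closed) (auto simp: basis_col_def)

lemma B_mat_index:
  assumes "i < n" "j < n"
  shows "B_mat n k l $$ (i, j) = (if j = (i + k) mod n then unit_root n ^ (i * l) else 0)"
proof -
  have n: "n \<ge> 1"
    using assms by simp
  define f where "f = (\<lambda>p. unit_root n ^ (p * l) \<cdot>\<^sub>m
              (basis_col n p * transpose_mat (basis_col n ((p + k) mod n))))"
  have f: "f \<in> {0..<n} \<rightarrow> carrier_mat n n"
    by (auto simp: f_def basis_col_def)
  have fi: "f p $$ (i, j) = (if p = i then (if j = (i + k) mod n then unit_root n ^ (i * l) else 0) else 0)"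
    if "p < n" for p
  proof -
    have "basis_col n p * transpose_mat (basis_col n ((p + k) mod n)) \<in> carrier_mat n n"
      by (auto simp: basis_col_def)
    then have "f p $$ (i, j) = unit_root n ^ (p * l) *
        (basis_col n p * transpose_mat (basis_col n ((p + k) mod n))) $$ (i, j)"
      unfolding f_def using assms by (intro index_smult_mat(1)) auto
    also have "(basis_col n p * transpose_mat (basis_col n ((p + k) mod n))) $$ (i, j)
        = (if i = p \<and> j = (p + k) mod n then 1 else 0)"
      using that assms n by (intro basis_col_outer_index) auto
    finally show ?thesis
      by auto
  qed
  show ?thesis
    unfolding B_mat_eq f_def[symmetric] using finsum_mat_index[OF f assms] assms by (simp add: fi)
qed

lemma mat_inner_B_mat:
  assumes "n \<ge> 1" "M \<in> carrier_mat n n"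
  shows "mat_inner M (B_mat n k l) = (\<Sum>i<n. M $$ (i, (i + k) mod n) * cnj (unit_root n ^ (i * l)))"
  using assms
  by (simp add: mat_inner_eq_sum[OF _ B_mat_carrier] B_mat_index if_distrib cong: if_cong)

lemma B_mat_gram:
  assumes "k < n" "l < n" "k' < n" "l' < n"
  shows "mat_inner (B_mat n k l) (B_mat n k' l') = (if k = k' \<and> l = l' then of_nat n else 0)"
proof -
  have n: "n \<ge> 1"
    using assms by simp
  have eq: "(i + k') mod n = (i + k) mod n \<longleftrightarrow> k = k'" for i
    using bij_betw_add_mod[of i n] assms by (auto simp: bij_betw_def dest: inj_onD)
  have "mat_inner (B_mat n k l) (B_mat n k' l')
      = (\<Sum>i<n. if k = k' then unit_root n ^ (i * l) * cnj (unit_root n ^ (i * l')) else 0)"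
    unfolding mat_inner_B_mat[OF n B_mat_carrier]
    using n by (intro sum.cong refl) (simp add: B_mat_index eq)
  then show ?thesis
    using unit_root_orthogonal[OF assms(2,4)] by (cases "k = k'"; cases "l = l'"; simp)
qed

text \<open>The factor \<open>\<omega>^(k l')\<close> arises because row \<open>i\<close> of the first matrix selects row \<open>i + k\<close> of the second,
  whose character value is \<open>\<omega>^((i + k) l')\<close>. Exponents of \<open>\<omega>\<close> may be reduced modulo \<open>n\<close>.\<close>

lemma B_mat_mult:
  assumes n: "n \<ge> 1"
  shows "B_mat n k l * B_mat n k' l'
    = unit_root n ^ (k * l') \<cdot>\<^sub>m B_mat n ((k + k') mod n) ((l + l') mod n)" (is "?L = ?R")
proof (rule eq_matI)
  note [simp] = B_mat_carrier[THEN carrier_matD(1)] B_mat_carrier[THEN carrier_matD(2)]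
  show "dim_row ?L = dim_row ?R" "dim_col ?L = dim_col ?R"
    by auto
  fix i j assume "i < dim_row ?R" "j < dim_col ?R"
  then have ij: "i < n" "j < n"
    by auto
  have "unit_root n ^ ((i + k) mod n * l') = unit_root n ^ ((i + k) * l')"
    by (metis mod_mult_left_eq n unit_root_power_mod)
  moreover have "unit_root n ^ (i * ((l + l') mod n)) = unit_root n ^ (i * (l + l'))"
    by (metis mod_mult_right_eq n unit_root_power_mod)
  moreover have "?L $$ (i, j) = unit_root n ^ (i * l) * (B_mat n k' l' $$ ((i + k) mod n, j))"
    unfolding mat_times_index[OF B_mat_carrier B_mat_carrier ij]
    using ij n by (simp add: B_mat_index[of i] if_distrib if_distribR cong: if_cong)
  moreover have "((i + k) mod n + k') mod n = (i + (k + k') mod n) mod n"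
    by (simp add: mod_simps add.assoc)
  ultimately show "?L $$ (i, j) = ?R $$ (i, j)"
    using ij n by (simp add: B_mat_index power_add[symmetric] algebra_simps)
qed

lemma B_mat_rank:
  assumes n: "n \<ge> 1"
  shows "vec_space.rank n (B_mat n k l) = n"
proof -
  let ?B = "B_mat n k l"
  note B = B_mat_carrier[of n k l]
  \<comment> \<open>Distinct rows are supported in distinct columns, with one unimodular entry each.\<close>
  have "?B * mat_adjoint ?B = 1\<^sub>m n"
  proof (rule eq_matI)
    fix i j assume "i < dim_row (1\<^sub>m n :: complex mat)" "j < dim_col (1\<^sub>m n :: complex mat)"
    then have ij: "i < n" "j < n"
      by auto
    have eq: "(i + k) mod n = (j + k) mod n \<longleftrightarrow> i = j"
      using bij_betw_add_mod[of k n] ij by (auto simp: bij_betw_def add.commute dest: inj_onD)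
    have "(?B * mat_adjoint ?B) $$ (i, j) = (\<Sum>m<n. ?B $$ (i, m) * cnj (?B $$ (j, m)))"
      unfolding mat_times_index[OF B mat_adjoint_carrier[OF B] ij]
      using ij by (simp add: mat_adjoint_index[OF B])
    also have "\<dots> = (\<Sum>m<n. if m = (i + k) mod n then (if i = j then 1 else 0) else 0)"
    proof (rule sum.cong[OF refl])
      fix m assume "m \<in> {..<n}"
      then have "m < n"
        by simp
      then show "?B $$ (i, m) * cnj (?B $$ (j, m))
          = (if m = (i + k) mod n then (if i = j then 1 else 0) else 0)"
        unfolding B_mat_index[OF ij(1) \<open>m < n\<close>] B_mat_index[OF ij(2) \<open>m < n\<close>]
        using eq unit_root_mult_cnj[of n "j * l"] by (cases "i = j") auto
    qed
    also have "\<dots> = 1\<^sub>m n $$ (i, j)"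
      using ij n by simp
    finally show "(?B * mat_adjoint ?B) $$ (i, j) = 1\<^sub>m n $$ (i, j)" .
  qed (use B mat_adjoint_carrier[OF B] in auto)
  then have "det ?B * det (mat_adjoint ?B) = 1"
    using det_mult[OF B mat_adjoint_carrier[OF B]] by simp
  then have "det ?B \<noteq> 0"
    by auto
  then show ?thesis
    using vec_space.det_rank_iff[OF B] by simp
qed

section \<open>The Fourier basis of the matrix space\<close>

lemma F_set_eq: "F_set n = (\<lambda>(k, l). B_mat n k l) ` ({..<n} \<times> {..<n})"
  by (auto simp: F_set_def)

lemma inj_on_B_mat: "inj_on (\<lambda>(k, l). B_mat n k l) ({..<n} \<times> {..<n})"
proof (rule inj_onI, clarsimp)
  fix k l k' l'
  assume "k < n" "l < n" "k' < n" "l' < n" "B_mat n k l = B_mat n k' l'"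
  then show "k = k' \<and> l = l'"
    using B_mat_gram[of k n l k' l'] B_mat_gram[of k n l k l] by (auto split: if_splits)
qed

lemma F_set_orthogonal:
  assumes "A \<in> F_set n" "M \<in> F_set n" "A \<noteq> M"
  shows "mat_inner A M = 0"
  using assms by (auto simp: F_set_def B_mat_gram)

text \<open>For fixed \<open>k\<close> the sum over \<open>l\<close> is discrete Fourier inversion along the \<open>k\<close>-th cyclic diagonal
  of \<open>M\<close>; the sum over \<open>k\<close> then selects the one diagonal through the entry \<open>(i, j)\<close>.\<close>

lemma F_set_expansion:
  assumes n: "n \<ge> 1" and M: "M \<in> carrier_mat n n" and ij: "i < n" "j < n"
  shows "(\<Sum>B\<in>F_set n. mat_inner M B / of_nat n * B $$ (i, j)) = M $$ (i, j)"
proof -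
  let ?w = "unit_root n"
  have inner: "(\<Sum>l<n. mat_inner M (B_mat n k l) * ?w ^ (i * l)) = of_nat n * M $$ (i, (i + k) mod n)" for k
  proof -
    have "(\<Sum>l<n. mat_inner M (B_mat n k l) * ?w ^ (i * l))
        = (\<Sum>l<n. \<Sum>a<n. M $$ (a, (a + k) mod n) * (?w ^ (l * i) * cnj (?w ^ (l * a))))"
      unfolding mat_inner_B_mat[OF n M]
      by (simp add: sum_distrib_right sum_distrib_left mult_ac)
    also have "\<dots> = (\<Sum>a<n. M $$ (a, (a + k) mod n) * (\<Sum>l<n. ?w ^ (l * i) * cnj (?w ^ (l * a))))"
      unfolding sum_distrib_left by (rule sum.swap)
    also have "\<dots> = (\<Sum>a<n. if i = a then M $$ (a, (a + k) mod n) * of_nat n else 0)"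
      using ij by (intro sum.cong refl) (subst unit_root_orthogonal, auto)
    finally show ?thesis
      using ij by simp
  qed
  have "(\<Sum>B\<in>F_set n. mat_inner M B / of_nat n * B $$ (i, j))
      = (\<Sum>k<n. \<Sum>l<n. mat_inner M (B_mat n k l) / of_nat n * B_mat n k l $$ (i, j))"
    unfolding F_set_eq sum.reindex[OF inj_on_B_mat]
    by (simp add: sum.cartesian_product case_prod_unfold)
  also have "\<dots> = (\<Sum>k<n. if j = (i + k) mod n
      then (\<Sum>l<n. mat_inner M (B_mat n k l) * ?w ^ (i * l)) / of_nat n else 0)"
    using ij by (intro sum.cong refl) (simp add: B_mat_index sum_divide_distrib)
  also have "\<dots> = (\<Sum>k<n. if j = (i + k) mod n then M $$ (i, (i + k) mod n) else 0)"
    unfolding inner using n by (intro sum.cong refl) auto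
  also have "\<dots> = (\<Sum>m<n. if j = m then M $$ (i, m) else 0)"
    by (rule sum.reindex_bij_betw[OF bij_betw_add_mod])
  finally show ?thesis
    using ij by simp
qed

lemma F_set_span:
  assumes n: "n \<ge> 1"
  shows "LinearCombinations.module.span class_ring (cmat_space n) (F_set n) = carrier_mat n n"
proof -
  interpret V: vectorspace class_ring "cmat_space n"
    by (rule matrix_vs)
  have F: "finite (F_set n)" "F_set n \<subseteq> carrier_mat n n"
    using B_mat_carrier by (auto simp: F_set_eq)
  have "V.span (F_set n) \<subseteq> carrier_mat n n"
    using V.span_is_subset2[of "F_set n"] F by (simp add: module_mat_simps)
  moreover have "M \<in> V.span (F_set n)" if M: "M \<in> carrier_mat n n" for M
  proof -
    let ?a = "\<lambda>B. mat_inner M B / of_nat n"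
    have f: "(\<lambda>B. ?a B \<cdot>\<^sub>m B) \<in> F_set n \<rightarrow> carrier_mat n n"
      using F by auto
    have lc: "V.lincomb ?a (F_set n) = finsum (cmat_space n) (\<lambda>B. ?a B \<cdot>\<^sub>m B) (F_set n)"
      by (simp add: V.lincomb_def module_mat_simps)
    have "V.lincomb ?a (F_set n) = M"
    proof (rule eq_matI)
      fix i j assume "i < dim_row M" "j < dim_col M"
      then have ij: "i < n" "j < n"
        using M by auto
      have "V.lincomb ?a (F_set n) $$ (i, j) = (\<Sum>B\<in>F_set n. (?a B \<cdot>\<^sub>m B) $$ (i, j))"
        unfolding lc using finsum_mat_index[OF f ij] by simp
      also have "\<dots> = (\<Sum>B\<in>F_set n. ?a B * B $$ (i, j))"
        using F ij by (intro sum.cong refl) auto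
      finally show "V.lincomb ?a (F_set n) $$ (i, j) = M $$ (i, j)"
        using F_set_expansion[OF n M ij] by simp
    qed (use finsum_mat_closed[OF f] M in \<open>auto simp: lc\<close>)
    then show ?thesis
      unfolding V.span_def mem_Collect_eq using F(1)
      by (intro exI[of _ ?a] exI[of _ "F_set n"]) auto
  qed
  ultimately show ?thesis
    by auto
qed

text \<open>The subspace required by the definition is the whole matrix space.\<close>

lemma F_set_orthogonal_basis:
  assumes n: "n \<ge> 1"
  shows "orthogonal_basis n (F_set n)"
proof -
  interpret V: vectorspace class_ring "cmat_space n"
    by (rule matrix_vs)
  have F: "finite (F_set n)" "F_set n \<subseteq> carrier_mat n n"
    using B_mat_carrier by (auto simp: F_set_eq)
  have whole: "(cmat_space n)\<lparr>carrier := carrier_mat n n\<rparr> = cmat_space n"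
    by (simp add: module_mat_def)
  have li: "\<not> V.lin_dep (F_set n)"
    using n by (intro lin_indpt_of_orthogonal F F_set_orthogonal) (auto simp: F_set_def B_mat_gram)
  have "V.basis (F_set n)"
    using li F F_set_span[OF n] by (simp add: V.basis_def module_mat_simps)
  moreover have "VectorSpace.subspace class_ring (carrier_mat n n) (cmat_space n)"
    using V.span_is_subspace[of "F_set n"] F F_set_span[OF n] by (simp add: module_mat_simps)
  ultimately have "orthogonal_basis_of n (carrier_mat n n) (F_set n)"
    unfolding orthogonal_basis_of_def whole using F_set_orthogonal by blast
  then show ?thesis
    unfolding orthogonal_basis_def ..
qed

lemma F_set_pseudo_closed:
  assumes n: "n \<ge> 1"
  shows "pseudo_closed n n (F_set n)"
proof -
  \<comment> \<open>Entries are \<open>0\<close> or \<open>n\<close>-th roots of unity, and both satisfy \<open>x^(n+1) = x\<close>.\<close>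
  have pow: "entrywise_pow A (n + 1) = A" if A_in: "A \<in> F_set n" for A
  proof -
    obtain k l where A: "A = B_mat n k l"
      using A_in by (auto simp: F_set_def)
    show ?thesis
      unfolding A entrywise_pow_def
      using B_mat_carrier[of n k l] unit_root_power_power_eq_1[OF n]
      by (intro eq_matI) (auto simp: B_mat_index)
  qed
  have closed: "\<exists>D\<in>carrier_mat n n. diagonal_mat D \<and> D ^\<^sub>m n = 1\<^sub>m n \<and> D * (A * C) \<in> F_set n"
    if AC: "A \<in> F_set n" "C \<in> F_set n" for A C
  proof -
    obtain k l k' l' where A: "A = B_mat n k l" and C: "C = B_mat n k' l'"
      using AC by (auto simp: F_set_def)
    \<comment> \<open>Conjugation inverts the root of unity that the product formula produces.\<close>
    define c where "c = cnj (unit_root n ^ (k * l'))"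
    let ?D = "c \<cdot>\<^sub>m 1\<^sub>m n"
    let ?P = "B_mat n ((k + k') mod n) ((l + l') mod n)"
    have "c ^ n = cnj ((unit_root n ^ (k * l')) ^ n)"
      by (simp add: c_def)
    then have "c ^ n = 1"
      by (simp only: unit_root_power_power_eq_1[OF n]) simp
    then have D_pow: "?D ^\<^sub>m n = 1\<^sub>m n"
      by (auto simp: smult_one_mat_pow)
    have "?D * (A * C) = (c * unit_root n ^ (k * l')) \<cdot>\<^sub>m ?P"
      unfolding A C B_mat_mult[OF n]
      by (subst mult_smult_assoc_mat[of _ n n _ n])
        (auto simp: B_mat_carrier left_mult_one_mat[of _ n n] smult_smult_mat)
    moreover have "c * unit_root n ^ (k * l') = 1"
      using unit_root_mult_cnj[of n "k * l'"] by (simp add: c_def mult.commute)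
    ultimately have "?D * (A * C) = ?P"
      by auto
    moreover have "?P \<in> F_set n"
      unfolding F_set_def using n by (intro CollectI exI conjI refl) auto
    ultimately have "?D * (A * C) \<in> F_set n"
      by simp
    with D_pow show ?thesis
      by (intro bexI[of _ ?D]) (auto simp: diagonal_mat_def)
  qed
  show ?thesis
    unfolding pseudo_closed_def
    using n F_set_orthogonal_basis[OF n] pow closed by blast
qed

theorem mainTheorem2:
  fixes n :: nat
  assumes "n \<ge> 1"
  shows "(\<forall>k<n. \<forall>l<n. vec_space.rank n (B_mat n k l) = n)
       \<and> pseudo_closed n n (F_set n)
       \<and> complete_orthogonal_basis n (F_set n)"
  unfolding complete_orthogonal_basis_def
  using assms B_mat_rank F_set_pseudo_closed F_set_orthogonal_basis F_set_span by blast

end
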